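(* Let $W_r$ be the free monoid of (finite) rank $r>1$. There exists a right act $S$ over $W_r$ with the following properties: (a) $S$ has maximal growth; (b) for any $k\ge1$, $S$ is $k$-transitive.
   Context: A right act $S$ over a monoid $M$ is a set with a map $S\times M\to S$ such that $s(xy)=(sx)y$ and $s1=s$. A right act $S$ over $M$ is called $k$-transitive if for any $2k$-tuple $(s_1,\ldots,s_k,s'_1,\ldots,s'_k)$ of elements of $S$ such that $s_1,\ldots,s_k$ are pairwise different, there is $m\in M$ such that $s_im=s'_i$ for all $i=1,\ldots,k$. Growth: $W(n)$ is the set of words of length at most $n$ in the $r$ free generators of $W_r$. For an act $T$ generated by a finite set $A$ the growth function is $g_{A,T}(n)=\#(A\,W(n))$. Functions $f,g$ are equivalent if for some nonnegative integers $C,C'$ one has $f(n)\le g(n+C)$ and $g(n)\le f(n+C')$ for all $n\ge0$. A finitely generated act has maximal growth if its growth function is equivalent to that of the free act of rank 1, i.e. to $r^n$ (this does not depend on the finite generating set). An arbitrary act has maximal growth if it contains a finitely generated subact of maximal growth. *)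

theory Defs
  imports "HOL-Algebra.Group"
begin

definition free_monoid :: "nat \<Rightarrow> nat list monoid" where
  "free_monoid r = \<lparr>carrier = lists {..<r}, mult = (@), one = []\<rparr>"

definition words_upto :: "nat \<Rightarrow> nat \<Rightarrow> nat list set" where
  "words_upto r n = {w \<in> carrier (free_monoid r). length w \<le> n}"

locale right_act = monoid M for M (structure) +
  fixes S :: "'s set" and act :: "'s \<Rightarrow> 'm \<Rightarrow> 's"
  assumes act_closed: "\<lbrakk>s \<in> S; x \<in> carrier M\<rbrakk> \<Longrightarrow> act s x \<in> S"
    and act_mult: "\<lbrakk>s \<in> S; x \<in> carrier M; y \<in> carrier M\<rbrakk> \<Longrightarrow> act s (x \<otimes> y) = act (act s x) y"
    and act_one: "s \<in> S \<Longrightarrow> act s \<one> = s"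

definition k_transitive ::
    "('m, 'b) monoid_scheme \<Rightarrow> 's set \<Rightarrow> ('s \<Rightarrow> 'm \<Rightarrow> 's) \<Rightarrow> nat \<Rightarrow> bool" where
  "k_transitive M S act k \<longleftrightarrow>
     (\<forall>s s' :: nat \<Rightarrow> 's. (\<forall>i<k. s i \<in> S) \<and> (\<forall>i<k. s' i \<in> S) \<and> inj_on s {..<k} \<longrightarrow>
        (\<exists>m\<in>carrier M. \<forall>i<k. act (s i) m = s' i))"

definition act_prod :: "('s \<Rightarrow> 'm \<Rightarrow> 's) \<Rightarrow> 's set \<Rightarrow> 'm set \<Rightarrow> 's set" where
  "act_prod act A X = {act a x | a x. a \<in> A \<and> x \<in> X}"

definition generates ::
    "('m, 'b) monoid_scheme \<Rightarrow> ('s \<Rightarrow> 'm \<Rightarrow> 's) \<Rightarrow> 's set \<Rightarrow> 's set \<Rightarrow> bool" where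
  "generates M act A T \<longleftrightarrow> A \<subseteq> T \<and> act_prod act A (carrier M) = T"

definition growth :: "nat \<Rightarrow> ('s \<Rightarrow> nat list \<Rightarrow> 's) \<Rightarrow> 's set \<Rightarrow> nat \<Rightarrow> nat" where
  "growth r act A n = card (act_prod act A (words_upto r n))"

definition growth_equiv :: "(nat \<Rightarrow> nat) \<Rightarrow> (nat \<Rightarrow> nat) \<Rightarrow> bool" where
  "growth_equiv f g \<longleftrightarrow> (\<exists>C C'. \<forall>n. f n \<le> g (n + C) \<and> g n \<le> f (n + C'))"

text \<open>The free act of rank 1 is the monoid acting on itself by right multiplication,
  generated by the identity.\<close>

definition free_act_growth :: "nat \<Rightarrow> nat \<Rightarrow> nat" where
  "free_act_growth r = growth r (mult (free_monoid r)) {one (free_monoid r)}"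

text \<open>The choice of the finite generating set \<open>A\<close> does not matter: see
  \<open>fg_maximal_growth_iff\<close> below.\<close>

definition fg_maximal_growth :: "nat \<Rightarrow> 's set \<Rightarrow> ('s \<Rightarrow> nat list \<Rightarrow> 's) \<Rightarrow> bool" where
  "fg_maximal_growth r T act \<longleftrightarrow>
     (\<exists>A. finite A \<and> generates (free_monoid r) act A T \<and>
          growth_equiv (growth r act A) (free_act_growth r))"

definition maximal_growth :: "nat \<Rightarrow> 's set \<Rightarrow> ('s \<Rightarrow> nat list \<Rightarrow> 's) \<Rightarrow> bool" where
  "maximal_growth r S act \<longleftrightarrow>
     (\<exists>T\<subseteq>S. right_act (free_monoid r) T act \<and> fg_maximal_growth r T act)"


lemma monoid_free_monoid: "monoid (free_monoid r)"
  by unfold_locales (auto simp: free_monoid_def)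

lemma right_act_free_act:
  "right_act (free_monoid r) (carrier (free_monoid r)) (mult (free_monoid r))"
  by (intro right_act.intro monoid_free_monoid) (unfold_locales, auto simp: free_monoid_def)

lemma generates_free_act:
  "generates (free_monoid r) (mult (free_monoid r)) {one (free_monoid r)} (carrier (free_monoid r))"
  by (auto simp: generates_def act_prod_def free_monoid_def)

lemma finite_words_upto: "finite (words_upto r n)"
proof -
  have "words_upto r n = {w. set w \<subseteq> {..<r} \<and> length w \<le> n}"
    by (auto simp: words_upto_def free_monoid_def)
  then show ?thesis by (simp add: finite_lists_length_le)
qed

lemma free_act_growth_eq: "free_act_growth r n = (\<Sum>i\<le>n. r ^ i)"
proof -
  have "act_prod (mult (free_monoid r)) {one (free_monoid r)} (words_upto r n)
      = {w. set w \<subseteq> {..<r} \<and> length w \<le> n}"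
    by (auto simp: act_prod_def words_upto_def free_monoid_def)
  then show ?thesis
    by (simp add: free_act_growth_def growth_def card_lists_length_le)
qed

lemma growth_equiv_sym: "growth_equiv f g \<Longrightarrow> growth_equiv g f"
  unfolding growth_equiv_def by blast

lemma growth_equiv_trans:
  assumes "growth_equiv f g" "growth_equiv g h"
  shows "growth_equiv f h"
proof -
  obtain C C' where 1: "\<And>n. f n \<le> g (n + C)" "\<And>n. g n \<le> f (n + C')"
    using assms(1) unfolding growth_equiv_def by blast
  obtain D D' where 2: "\<And>n. g n \<le> h (n + D)" "\<And>n. h n \<le> g (n + D')"
    using assms(2) unfolding growth_equiv_def by blast
  have "f n \<le> h (n + (C + D)) \<and> h n \<le> f (n + (D' + C'))" for n
    using order_trans[OF 1(1) 2(1)] order_trans[OF 2(2) 1(2)] by (simp add: add.assoc)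
  then show ?thesis unfolding growth_equiv_def by blast
qed

lemma free_act_growth_equiv_power:
  assumes "r > 1"
  shows "growth_equiv (free_act_growth r) (\<lambda>n. r ^ n)"
proof -
  have "free_act_growth r n \<le> r ^ (n + 1)" for n
  proof (induction n)
    case 0
    then show ?case using assms by (simp add: free_act_growth_eq)
  next
    case (Suc n)
    have "free_act_growth r (Suc n) \<le> 2 * r ^ Suc n"
      using Suc by (simp add: free_act_growth_eq)
    also have "\<dots> \<le> r * r ^ Suc n"
      using assms by (intro mult_right_mono) auto
    finally show ?case by simp
  qed
  moreover have "r ^ n \<le> free_act_growth r (n + 0)" for n
    by (simp add: free_act_growth_eq member_le_sum)
  ultimately show ?thesis unfolding growth_equiv_def by blast
qed

lemma growth_le_shift:
  assumes act: "right_act (free_monoid r) T act"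
    and A: "finite A" "A \<subseteq> T"
    and B: "finite B" "generates (free_monoid r) act B T"
  shows "\<exists>C. \<forall>n. growth r act A n \<le> growth r act B (n + C)"
proof -
  interpret right_act "free_monoid r" T act by (rule act)
  have "\<forall>a\<in>A. \<exists>b w. b \<in> B \<and> w \<in> carrier (free_monoid r) \<and> a = act b w"
    using A B unfolding generates_def act_prod_def by blast
  then obtain b w where bw: "\<And>a. a \<in> A \<Longrightarrow>
      b a \<in> B \<and> w a \<in> carrier (free_monoid r) \<and> a = act (b a) (w a)"
    by metis
  define C where "C = (\<Sum>a\<in>A. length (w a))"
  have C: "length (w a) \<le> C" if "a \<in> A" for a
    unfolding C_def using that A by (intro member_le_sum) auto
  have "growth r act A n \<le> growth r act B (n + C)" for n
  proof -
    have "act_prod act A (words_upto r n) \<subseteq> act_prod act B (words_upto r (n + C))"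
    proof
      fix s assume "s \<in> act_prod act A (words_upto r n)"
      then obtain a x where ax: "a \<in> A" "x \<in> words_upto r n" "s = act a x"
        unfolding act_prod_def by blast
      have x: "x \<in> carrier (free_monoid r)" "length x \<le> n"
        using ax by (auto simp: words_upto_def)
      have b: "b a \<in> T" using bw[OF ax(1)] B by (auto simp: generates_def)
      have "s = act (b a) (w a \<otimes>\<^bsub>free_monoid r\<^esub> x)"
        using act_mult[OF b _ x(1)] bw[OF ax(1)] ax(3) by metis
      moreover have "w a \<otimes>\<^bsub>free_monoid r\<^esub> x \<in> words_upto r (n + C)"
        using bw[OF ax(1)] C[OF ax(1)] x by (auto simp: words_upto_def free_monoid_def)
      ultimately show "s \<in> act_prod act B (words_upto r (n + C))"
        using bw[OF ax(1)] unfolding act_prod_def by blast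
    qed
    moreover have "act_prod act B (words_upto r (n + C))
        = (\<lambda>(b, x). act b x) ` (B \<times> words_upto r (n + C))"
      by (auto simp: act_prod_def)
    then have "finite (act_prod act B (words_upto r (n + C)))"
      using B finite_words_upto by simp
    ultimately show ?thesis unfolding growth_def by (rule card_mono[rotated])
  qed
  then show ?thesis by blast
qed

lemma growth_equiv_generating_sets:
  assumes "right_act (free_monoid r) T act"
    and "finite A" "generates (free_monoid r) act A T"
    and "finite B" "generates (free_monoid r) act B T"
  shows "growth_equiv (growth r act A) (growth r act B)"
proof -
  have "A \<subseteq> T" "B \<subseteq> T" using assms by (auto simp: generates_def)
  then show ?thesis
    using growth_le_shift[of r T act A B] growth_le_shift[of r T act B A] assms
    unfolding growth_equiv_def by blast
qed

lemma fg_maximal_growth_iff: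
  assumes "right_act (free_monoid r) T act"
    and "finite A" "generates (free_monoid r) act A T"
  shows "fg_maximal_growth r T act \<longleftrightarrow> growth_equiv (growth r act A) (free_act_growth r)"
  unfolding fg_maximal_growth_def
  using assms growth_equiv_generating_sets growth_equiv_trans by blast

end

theory Submission
  imports Defs "HOL-Library.Countable"
begin

text \<open>
  Start from the free act on the words in \<open>{..<r}\<close> and enumerate all transitivity tasks, that is,
  all finite lists of pairs \<open>(a, b)\<close> with distinct sources \<open>a\<close>. For the \<open>j\<close>-th task choose a large
  exponent \<open>N\<close> and redirect the edge labelled \<open>0\<close> that leaves \<open>a1\<^sup>N\<close> to the target \<open>b\<close>. The edges
  labelled \<open>1\<close> are never touched, so \<open>1\<^sup>N0\<close> solves the task. If the exponents grow fast enough, then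
  tasks do not interfere, and fewer than \<open>n\<close> edges are redirected at each depth \<open>n \<ge> 1\<close> and none at the root; hence more
  than \<open>r\<^sup>n\<^sup>-\<^sup>1\<close> of the \<open>r\<^sup>n\<close> words of length \<open>n\<close> are still reached from the root along
  their own letters.
\<close>

text \<open>The decoded list may be arbitrary; an ill-formed one becomes the empty task, which
  redirects nothing.\<close>

definition task :: "nat \<Rightarrow> nat \<Rightarrow> (nat list \<times> nat list) list" where
  "task r j = (let ps = from_nat j in
     if distinct (map fst ps) \<and> set ps \<subseteq> lists {..<r} \<times> lists {..<r} then ps else [])"

text \<open>The sum over \<open>i < j\<close> puts the redirections of task \<open>j\<close>
  strictly deeper than those of all earlier tasks. The last two summands make their depth exceed the
  number of edges that task \<open>j\<close> redirects.\<close>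

definition exponent :: "nat \<Rightarrow> nat \<Rightarrow> nat" where
  "exponent r j = (\<Sum>i<j. 1 + length (task r i) + (\<Sum>p\<leftarrow>task r i. length (fst p)))
     + length (task r j) + 1"

definition redirect :: "nat \<Rightarrow> nat list \<Rightarrow> nat list \<Rightarrow> bool" where
  "redirect r p q \<longleftrightarrow> (\<exists>j a. (a, q) \<in> set (task r j) \<and> p = a @ replicate (exponent r j) 1)"

definition step :: "nat \<Rightarrow> nat list \<Rightarrow> nat \<Rightarrow> nat list" where
  "step r p x = (if x = 0 \<and> (\<exists>q. redirect r p q) then THE q. redirect r p q else p @ [x])"

text \<open>Vertices are coded as natural numbers because the act is to live on a
  \<open>nat set\<close>.\<close>

definition word_act :: "nat \<Rightarrow> nat \<Rightarrow> nat list \<Rightarrow> nat" where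
  "word_act r s w = to_nat (foldl (step r) (from_nat s) w)"

section \<open>Redirections do not collide\<close>

lemma distinct_task: "distinct (map fst (task r j))"
  by (auto simp: task_def Let_def)

lemma task_subset: "set (task r j) \<subseteq> lists {..<r} \<times> lists {..<r}"
  unfolding task_def Let_def by (auto split: if_splits)

lemma exponent_separated:
  assumes "i < j" "(a, b) \<in> set (task r i)"
  shows "length a + exponent r i < exponent r j"
proof -
  let ?m = "\<lambda>i. 1 + length (task r i) + (\<Sum>p\<leftarrow>task r i. length (fst p))"
  have "length a \<le> (\<Sum>p\<leftarrow>task r i. length (fst p))"
    using assms(2) by (intro member_le_sum_list) force+
  moreover have "sum ?m {..<Suc i} \<le> sum ?m {..<j}"
    using assms(1) by (intro sum_mono2) auto
  ultimately show ?thesis unfolding exponent_def by simp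
qed

text \<open>Different tasks redirect at disjoint sets of depths. This serves both the uniqueness of
  targets and the count at each depth.\<close>

lemma redirect_index_unique:
  assumes "(a, b) \<in> set (task r i)" "(a', b') \<in> set (task r j)"
    and "length a + exponent r i = length a' + exponent r j"
  shows "i = j"
proof (rule linorder_cases[of i j])
  assume "i < j"
  then show ?thesis using exponent_separated[OF _ assms(1), of j] assms(3) by linarith
next
  assume "j < i"
  then show ?thesis using exponent_separated[OF _ assms(2), of i] assms(3) by linarith
qed

text \<open>Both redirections start at the same depth, so they come from one task. Cancelling the
  common block of ones leaves the same source, and sources within a task are distinct. This
  justifies the \<open>THE\<close> in \<open>step\<close>.\<close>

lemma redirect_unique:
  assumes "redirect r p q" "redirect r p q'"
  shows "q = q'"
proof -
  obtain i a where i: "(a, q) \<in> set (task r i)" "p = a @ replicate (exponent r i) 1"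
    using assms(1) unfolding redirect_def by blast
  obtain j b where j: "(b, q') \<in> set (task r j)" "p = b @ replicate (exponent r j) 1"
    using assms(2) unfolding redirect_def by blast
  have "length a + exponent r i = length b + exponent r j"
    using i(2) j(2) by (metis length_append length_replicate)
  then have "i = j" using redirect_index_unique i(1) j(1) by blast
  then have "a = b" using i(2) j(2) by simp
  then show ?thesis using i(1) j(1) \<open>i = j\<close> distinct_task eq_key_imp_eq_value by metis
qed

lemma step_redirect: "redirect r p q \<Longrightarrow> step r p 0 = q"
  unfolding step_def by (auto intro: the_equality redirect_unique)

lemma step_append: "x \<noteq> 0 \<or> (\<nexists>q. redirect r p q) \<Longrightarrow> step r p x = p @ [x]"
  by (auto simp: step_def)

lemma step_closed:
  assumes "p \<in> lists {..<r}" "x < r"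
  shows "step r p x \<in> lists {..<r}"
proof (cases "x = 0 \<and> (\<exists>q. redirect r p q)")
  case True
  then obtain q where q: "redirect r p q" by blast
  then have "q \<in> lists {..<r}" unfolding redirect_def using task_subset by blast
  then show ?thesis using True step_redirect[OF q] by simp
next
  case False
  then show ?thesis using assms step_append[of x r p] by auto
qed

lemma foldl_step_closed:
  "p \<in> lists {..<r} \<Longrightarrow> w \<in> lists {..<r} \<Longrightarrow> foldl (step r) p w \<in> lists {..<r}"
  by (induction w arbitrary: p) (simp_all add: step_closed)

lemma foldl_step_replicate: "foldl (step r) p (replicate n 1) = p @ replicate n 1"
  by (induction n arbitrary: p) (auto simp: step_append)

section \<open>The act and its transitivity\<close>

lemma right_act_word_act: "right_act (free_monoid r) (to_nat ` lists {..<r}) (word_act r)"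
proof (intro right_act.intro monoid_free_monoid, unfold_locales, goal_cases)
  case (1 s x)
  then obtain p where "s = to_nat p" "p \<in> lists {..<r}" by blast
  with 1 show ?case
    using foldl_step_closed by (simp add: word_act_def free_monoid_def)
qed (auto simp: word_act_def free_monoid_def)

lemma k_transitive_word_act:
  assumes "r > 1"
  shows "k_transitive (free_monoid r) (to_nat ` lists {..<r}) (word_act r) k"
  unfolding k_transitive_def
proof (intro allI impI, elim conjE)
  fix s s' :: "nat \<Rightarrow> nat"
  let ?S = "to_nat ` lists {..<r}"
  assume s: "\<forall>i<k. s i \<in> ?S" and s': "\<forall>i<k. s' i \<in> ?S" and inj: "inj_on s {..<k}"
  define a b :: "nat \<Rightarrow> nat list" where "a i = from_nat (s i)" and "b i = from_nat (s' i)" for i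
  have a: "a i \<in> lists {..<r}" "to_nat (a i) = s i" if "i < k" for i
    using s that unfolding a_def by (metis from_nat_to_nat imageE)+
  have b: "b i \<in> lists {..<r}" "to_nat (b i) = s' i" if "i < k" for i
    using s' that unfolding b_def by (metis from_nat_to_nat imageE)+
  define ps where "ps = map (\<lambda>i. (a i, b i)) [0..<k]"
  \<comment> \<open>The required assignment is itself a task, with its code as index; injectivity of
    \<open>s\<close> keeps \<open>task\<close> from falling back to the empty list.\<close>
  define j where "j = to_nat ps"
  have "inj_on a {..<k}"
    using inj a(2) by (metis (no_types, lifting) inj_on_def lessThan_iff)
  then have "distinct (map fst ps)"
    by (simp add: ps_def comp_def distinct_map atLeast0LessThan)
  moreover have "set ps \<subseteq> lists {..<r} \<times> lists {..<r}"
    using a(1) b(1) unfolding ps_def by (simp add: image_subset_iff)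
  ultimately have task: "task r j = ps"
    by (simp add: task_def j_def)
  let ?m = "replicate (exponent r j) 1 @ [0]"
  have "word_act r (s i) ?m = s' i" if "i < k" for i
  proof -
    have "(a i, b i) \<in> set (task r j)" using that unfolding task ps_def by auto
    then have "redirect r (a i @ replicate (exponent r j) 1) (b i)"
      unfolding redirect_def by blast
    from step_redirect[OF this] have "foldl (step r) (a i) ?m = b i"
      by (simp only: foldl_append foldl_step_replicate foldl.simps)
    then show ?thesis using b(2)[OF that] unfolding word_act_def a_def by simp
  qed
  moreover have "?m \<in> carrier (free_monoid r)"
    using assms by (auto simp: free_monoid_def)
  ultimately show "\<exists>m\<in>carrier (free_monoid r). \<forall>i<k. word_act r (s i) m = s' i"
    by blast
qed

section \<open>Counting words that lead from the root to themselves\<close>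

lemma redirected_at_depth:
  defines "R \<equiv> \<lambda>r n. {p. length p = n \<and> (\<exists>q. redirect r p q)}"
  shows "finite (R r n)" "card (R r n) \<le> n - 1"
proof -
  have "finite (R r n) \<and> card (R r n) \<le> n - 1"
  proof (cases "R r n = {}")
    case False
    then obtain a q j where j: "(a, q) \<in> set (task r j)" "length a + exponent r j = n"
      unfolding R_def redirect_def by auto
    let ?f = "\<lambda>p. fst p @ replicate (exponent r j) 1"
    \<comment> \<open>Only task \<open>j\<close> redirects at depth \<open>n\<close>, so its pairs
      account for the whole set.\<close>
    have sub: "R r n \<subseteq> ?f ` set (task r j)"
    proof
      fix p assume "p \<in> R r n"
      then obtain b q' i where i: "(b, q') \<in> set (task r i)"
          "p = b @ replicate (exponent r i) 1" "length p = n"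
        unfolding R_def redirect_def by auto
      then have "i = j" using redirect_index_unique[OF i(1) j(1)] j(2) by simp
      then show "p \<in> ?f ` set (task r j)" using i by force
    qed
    have "card (R r n) \<le> card (set (task r j))"
      using card_mono[OF _ sub] card_image_le[of "set (task r j)" ?f] by simp
    also have "\<dots> \<le> length (task r j)" by (rule card_length)
    \<comment> \<open>The exponent, and hence the depth \<open>n\<close>, is at least
      \<open>length (task r j) + 1\<close>.\<close>
    also have "\<dots> \<le> n - 1" using j(2) unfolding exponent_def by simp
    finally show ?thesis using sub finite_surj[of "set (task r j)"] by auto
  qed simp
  then show "finite (R r n)" "card (R r n) \<le> n - 1" by auto
qed

text \<open>Only the end of the path is prescribed. Distinct words of this kind reach distinct
  vertices, so their number bounds the growth from below.\<close>

definition unredirected :: "nat \<Rightarrow> nat \<Rightarrow> nat list set" where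
  "unredirected r n = {w \<in> lists {..<r}. length w = n \<and> foldl (step r) [] w = w}"

lemma finite_unredirected: "finite (unredirected r n)"
  by (rule finite_subset[OF _ finite_words_upto[of r n]])
    (auto simp: unredirected_def words_upto_def free_monoid_def)

text \<open>Append every letter to each word counted at \<open>n\<close>. An extension can fail only
  for the letter \<open>0\<close> at a redirected vertex of depth \<open>n\<close>.\<close>

lemma card_unredirected_Suc:
  "r * card (unredirected r n) - (n - 1) \<le> card (unredirected r (Suc n))"
proof -
  define R where "R = {p. length p = n \<and> (\<exists>q. redirect r p q)}"
  let ?f = "\<lambda>(p, x). p @ [x]"
  have R: "finite R" "card R \<le> n - 1"
    using redirected_at_depth[of n r] by (auto simp: R_def)
  have "?f ` (unredirected r n \<times> {..<r}) - (\<lambda>p. p @ [0]) ` R \<subseteq> unredirected r (Suc n)"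
  proof
    fix w assume w: "w \<in> ?f ` (unredirected r n \<times> {..<r}) - (\<lambda>p. p @ [0]) ` R"
    then obtain p x where p: "w = p @ [x]" "p \<in> unredirected r n" "x < r" by auto
    moreover have "x \<noteq> 0 \<or> (\<nexists>q. redirect r p q)"
      using w p by (auto simp: R_def unredirected_def)
    ultimately show "w \<in> unredirected r (Suc n)"
      using step_append[of x r p] by (auto simp: unredirected_def)
  qed
  then have "card (?f ` (unredirected r n \<times> {..<r}) - (\<lambda>p. p @ [0]) ` R)
      \<le> card (unredirected r (Suc n))"
    by (intro card_mono finite_unredirected)
  moreover have "card (?f ` (unredirected r n \<times> {..<r})) = r * card (unredirected r n)"
    by (subst card_image) (auto simp: inj_on_def card_cartesian_product)
  moreover have "card ((\<lambda>p. p @ [0]) ` R) \<le> n - 1"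
    using card_image_le[OF R(1)] R(2) le_trans by blast
  ultimately show ?thesis
    using diff_card_le_card_Diff[of "(\<lambda>p. p @ [0]) ` R" "?f ` (unredirected r n \<times> {..<r})"] R(1)
    by simp
qed

text \<open>The summand \<open>Suc n\<close> strengthens the induction: multiplying by
  \<open>r\<close> at least doubles it to \<open>2 * Suc n\<close>, and after the loss of at most
  \<open>n\<close> words \<open>n + 2\<close> is still left.\<close>

lemma card_unredirected_ge:
  assumes "r > 1"
  shows "r ^ n + Suc n \<le> card (unredirected r (Suc n))"
proof (induction n)
  case 0
  have "unredirected r 0 = {[]}" by (auto simp: unredirected_def)
  then show ?case using card_unredirected_Suc[of r 0] assms by simp
next
  case (Suc n)
  have "r ^ Suc n + 2 * Suc n \<le> r * (r ^ n + Suc n)"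
    using assms mult_le_mono1[of 2 r "Suc n"] by (simp only: distrib_left power_Suc) linarith
  also have "\<dots> \<le> r * card (unredirected r (Suc n))"
    using Suc by (intro mult_le_mono2) simp
  finally show ?case using card_unredirected_Suc[of r "Suc n"] by simp
qed

section \<open>Maximal growth\<close>

lemma growth_word_act:
  assumes "r > 1"
  shows "growth_equiv (growth r (word_act r) {to_nat ([] :: nat list)}) (free_act_growth r)"
proof -
  let ?g = "growth r (word_act r) {to_nat ([] :: nat list)}"
  have g: "?g n = card ((\<lambda>w. foldl (step r) [] w) ` words_upto r n)" for n
  proof -
    have "act_prod (word_act r) {to_nat ([] :: nat list)} (words_upto r n)
        = to_nat ` (\<lambda>w. foldl (step r) [] w) ` words_upto r n"
      by (auto simp: act_prod_def word_act_def)
    then show ?thesis by (simp add: growth_def card_image inj_on_def)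
  qed
  have upper: "?g n \<le> free_act_growth r n" for n
  proof -
    have "act_prod (mult (free_monoid r)) {one (free_monoid r)} (words_upto r n) = words_upto r n"
      by (auto simp: act_prod_def free_monoid_def)
    then show ?thesis
      unfolding g by (simp add: free_act_growth_def growth_def card_image_le finite_words_upto)
  qed
  have lower: "r ^ n \<le> ?g (n + 1)" for n
  proof -
    have "unredirected r (Suc n) \<subseteq> (\<lambda>w. foldl (step r) [] w) ` words_upto r (n + 1)"
      by (force simp: unredirected_def words_upto_def free_monoid_def)
    then have "card (unredirected r (Suc n)) \<le> ?g (n + 1)"
      unfolding g by (intro card_mono finite_imageI finite_words_upto)
    then show ?thesis using card_unredirected_ge[OF assms, of n] by linarith
  qed
  obtain C where "\<And>n. free_act_growth r n \<le> r ^ (n + C)"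
    using free_act_growth_equiv_power[OF assms] unfolding growth_equiv_def by blast
  \<comment> \<open>The shift \<open>C\<close> passes to a pure power of \<open>r\<close>, and one
    more comes from \<open>lower\<close>.\<close>
  then have "free_act_growth r n \<le> ?g (n + (C + 1))" for n
    using lower[of "n + C"] order_trans by (metis add.assoc)
  then show ?thesis
    using upper unfolding growth_equiv_def by (metis add_0_right)
qed

text \<open>By 1-transitivity the root reaches every vertex, so the whole act is finitely generated
  and can serve as its own subact of maximal growth.\<close>

lemma generates_word_act:
  assumes "r > 1"
  shows "generates (free_monoid r) (word_act r) {to_nat ([] :: nat list)} (to_nat ` lists {..<r})"
proof -
  interpret right_act "free_monoid r" "to_nat ` lists {..<r}" "word_act r"
    by (rule right_act_word_act)
  let ?e = "to_nat ([] :: nat list)"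
  have e: "?e \<in> to_nat ` lists {..<r}" by blast
  have "\<exists>m\<in>carrier (free_monoid r). word_act r ?e m = t" if "t \<in> to_nat ` lists {..<r}" for t
  proof -
    have "k_transitive (free_monoid r) (to_nat ` lists {..<r}) (word_act r) 1"
      by (rule k_transitive_word_act[OF assms])
    \<comment> \<open>The two sequences are taken constant; on the single index \<open>0\<close>
      injectivity is trivial.\<close>
    then have "(\<forall>i<1::nat. ?e \<in> to_nat ` lists {..<r}) \<and> (\<forall>i<1::nat. t \<in> to_nat ` lists {..<r}) \<and>
        inj_on (\<lambda>_. ?e) {..<1::nat} \<longrightarrow>
        (\<exists>m\<in>carrier (free_monoid r). \<forall>i<1::nat. word_act r ?e m = t)"
      unfolding k_transitive_def by (elim allE)
    moreover have "inj_on (\<lambda>_. ?e) {..<1::nat}" by (simp add: inj_on_def)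
    ultimately have "\<exists>m\<in>carrier (free_monoid r). \<forall>i<1::nat. word_act r ?e m = t"
      using e that by simp
    then show ?thesis by simp
  qed
  moreover have "word_act r ?e m \<in> to_nat ` lists {..<r}" if "m \<in> carrier (free_monoid r)" for m
    by (rule act_closed[OF e that])
  ultimately have "t \<in> act_prod (word_act r) {?e} (carrier (free_monoid r))
      \<longleftrightarrow> t \<in> to_nat ` lists {..<r}" for t
    unfolding act_prod_def mem_Collect_eq by (metis singletonD singletonI)
  then have "act_prod (word_act r) {?e} (carrier (free_monoid r)) = to_nat ` lists {..<r}"
    by (simp only: set_eq_iff simp_thms)
  with e show ?thesis
    unfolding generates_def by simp
qed

theorem theorem1:
  fixes r :: nat
  assumes "r > 1"
  shows "\<exists>(S :: nat set) (act :: nat \<Rightarrow> nat list \<Rightarrow> nat).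
           right_act (free_monoid r) S act \<and>
           maximal_growth r S act \<and>
           (\<forall>k\<ge>1. k_transitive (free_monoid r) S act k)"
proof (intro exI conjI allI impI)
  show act: "right_act (free_monoid r) (to_nat ` lists {..<r}) (word_act r)"
    by (rule right_act_word_act)
  show "maximal_growth r (to_nat ` lists {..<r}) (word_act r)"
    unfolding maximal_growth_def fg_maximal_growth_def
    using act generates_word_act[OF assms] growth_word_act[OF assms]
    by (meson finite.emptyI finite.insertI subset_refl)
  show "k_transitive (free_monoid r) (to_nat ` lists {..<r}) (word_act r) k" for k
    by (rule k_transitive_word_act[OF assms])
qed

end
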